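(* Let $n\ge 1$. For every web $w\in\mathcal{W}_n$, the distance from $w_0$ in the web graph, the nesting number, and the number of inversions of the permutation of the corresponding tableau all agree: $$\mathrm{dist}(w_0,w)=n(w)=\#\text{ inversions of }\sigma_{\psi^{-1}(w)}.$$
   Context: A web on $2n$ points is a noncrossing perfect matching of $1,\dots,2n$ (arcs above a horizontal axis); $(i,j)$ denotes an arc with endpoints $i<j$, and $\{i,j\}$ an arc whose endpoints are not necessarily listed in order. $\mathcal{W}_n$ is the set of webs on $2n$ points and $V^{\mathcal{W}_n}$ the complex vector space with basis $\mathcal{W}_n$. The transposition $s_i=(i\ i{+}1)\in S_{2n}$ acts by: $s_i\cdot w=-w$ if $(i,i+1)$ is an arc of $w$; otherwise, if $w$ contains $\{i,j\}$ and $\{i+1,k\}$, then $s_i\cdot w=w+w'$ where $w'$ is obtained from $w$ by replacing these two arcs by $(i,i+1)$ and $\{j,k\}$. Web graph: directed graph on $\mathcal{W}_n$ with an edge $w\stackrel{s_i}{\longrightarrow}w'$ iff $s_i\cdot w=w+w'$ and $w$ contains arcs $(j,i)$ and $(i+1,k)$ with $j<i<i+1<k$. $w_0$ is the web with arcs $(1,2),(3,4),\dots,(2n-1,2n)$; $\mathrm{dist}(w_0,w)$ is the length of a shortest directed path from $w_0$ to $w$ in the web graph. Nesting number: for an arc $a$ of $w$, $n(a)$ is the number of arcs of $w$ that $a$ is nested beneath ($(r,s)$ is nested beneath $(r',s')$ if $r'<r<s<s'$); $n(w)=\sum_a n(a)$ over all arcs $a$ of $w$. $\mathcal{T}_n$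 is the set of standard Young tableaux of shape $(n,n)$ ($2\times n$ fillings with $1,\dots,2n$, increasing along rows and down columns). The bijection $\psi:\mathcal{T}_n\to\mathcal{W}_n$: process the bottom row of $T$ from left to right, joining each entry's vertex by an arc to the nearest not-yet-matched vertex to its left. $\sigma_T$ is the permutation whose one-line notation is obtained by reading the entries of $T$ down each column, from the leftmost to the rightmost column. An inversion is a pair of entries $a>b$ with $a$ appearing to the left of $b$ in one-line notation. *)

theory Defs
  imports Complex_Main "HOL-Library.Poly_Mapping" "HOL-Library.Extended_Nat"
begin

text \<open>A web is the set of its arcs; the arc joining \<open>i < j\<close> is the pair \<open>(i, j)\<close>.\<close>

type_synonym web = "(nat \<times> nat) set"

definition arc_of :: "nat \<Rightarrow> nat \<Rightarrow> nat \<times> nat"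
  where "arc_of a b = (min a b, max a b)"

definition webs :: "nat \<Rightarrow> web set"
  where "webs n = {w.
    (\<forall>(i, j) \<in> w. 1 \<le> i \<and> i < j \<and> j \<le> 2 * n) \<and>
    (\<forall>v \<in> {1..2 * n}. \<exists>!a. a \<in> w \<and> (v = fst a \<or> v = snd a)) \<and>
    (\<forall>(i, j) \<in> w. \<forall>(k, l) \<in> w. \<not> (i < k \<and> k < j \<and> j < l))}"

definition partner :: "web \<Rightarrow> nat \<Rightarrow> nat"
  where "partner w v = (THE u. (u, v) \<in> w \<or> (v, u) \<in> w)"

definition reconnect :: "nat \<Rightarrow> web \<Rightarrow> web"
  where "reconnect i w =
    (let j = partner w i; k = partner w (i + 1)
     in w - {arc_of i j, arc_of (i + 1) k} \<union> {(i, i + 1), arc_of j k})"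

text \<open>The space with basis \<open>webs n\<close> consists of the finitely supported functions \<open>v\<close> with
  \<open>Poly_Mapping.keys v \<subseteq> webs n\<close>. The action of \<open>s\<^sub>i\<close> is given on basis vectors and extended
  linearly.\<close>

type_synonym web_vec = "web \<Rightarrow>\<^sub>0 complex"

definition basis_vec :: "web \<Rightarrow> web_vec"
  where "basis_vec w = Poly_Mapping.single w 1"

definition s_basis :: "nat \<Rightarrow> web \<Rightarrow> web_vec"
  where "s_basis i w =
    (if (i, i + 1) \<in> w then - basis_vec w
     else basis_vec w + basis_vec (reconnect i w))"

definition s_act :: "nat \<Rightarrow> web_vec \<Rightarrow> web_vec"
  where "s_act i v =
    (\<Sum>w \<in> Poly_Mapping.keys v.
       Poly_Mapping.map ((*) (Poly_Mapping.lookup v w)) (s_basis i w))"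

lemma s_act_basis_vec: "s_act i (basis_vec w) = s_basis i w"
proof -
  have "Poly_Mapping.map ((*) 1) p = p" for p :: web_vec
    by (rule poly_mapping_eqI) (simp add: map.rep_eq when_def)
  then show ?thesis
    by (simp add: s_act_def basis_vec_def)
qed

definition web_edge :: "nat \<Rightarrow> nat \<Rightarrow> web \<Rightarrow> web \<Rightarrow> bool"
  where "web_edge n i w w' \<longleftrightarrow>
    w \<in> webs n \<and> w' \<in> webs n \<and> 1 \<le> i \<and> i + 1 \<le> 2 * n \<and>
    s_act i (basis_vec w) = basis_vec w + basis_vec w' \<and>
    (\<exists>j k. (j, i) \<in> w \<and> (i + 1, k) \<in> w \<and> j < i \<and> i + 1 < k)"

definition web_graph :: "nat \<Rightarrow> (web \<times> web) set"
  where "web_graph n = {(w, w'). \<exists>i. web_edge n i w w'}"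

text \<open>Directed paths of length \<open>k\<close> are given by the \<open>k\<close>-th relational power; the distance is
  \<open>\<infinity>\<close> if there is no path.\<close>

definition web_dist :: "nat \<Rightarrow> web \<Rightarrow> web \<Rightarrow> enat"
  where "web_dist n u v = (INF k \<in> {k. (u, v) \<in> web_graph n ^^ k}. enat k)"

definition web0 :: "nat \<Rightarrow> web"
  where "web0 n = {(2 * m - 1, 2 * m) | m. m \<in> {1..n}}"

definition nested_beneath :: "nat \<times> nat \<Rightarrow> nat \<times> nat \<Rightarrow> bool"
  where "nested_beneath a b \<longleftrightarrow> fst b < fst a \<and> fst a < snd a \<and> snd a < snd b"

definition arc_nesting :: "web \<Rightarrow> nat \<times> nat \<Rightarrow> nat"
  where "arc_nesting w a = card {b \<in> w. nested_beneath a b}"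

definition nesting_number :: "web \<Rightarrow> nat"
  where "nesting_number w = (\<Sum>a \<in> w. arc_nesting w a)"

text \<open>A tableau with two rows is the pair (top row, bottom row).\<close>

type_synonym tableau2 = "nat list \<times> nat list"

definition SYT2 :: "nat \<Rightarrow> tableau2 set"
  where "SYT2 n = {(t, b).
    length t = n \<and> length b = n \<and>
    distinct (t @ b) \<and> set (t @ b) = {1..2 * n} \<and>
    sorted_wrt (<) t \<and> sorted_wrt (<) b \<and> (\<forall>m < n. t ! m < b ! m)}"

definition join_left :: "nat \<Rightarrow> web \<Rightarrow> web"
  where "join_left v w =
    insert (Max {u. 1 \<le> u \<and> u < v \<and> u \<notin> fst ` w \<union> snd ` w}, v) w"

definition tableau_web :: "tableau2 \<Rightarrow> web"
  where "tableau_web T = fold join_left (snd T) {}"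

definition column_word :: "tableau2 \<Rightarrow> nat list"
  where "column_word T = concat (map (\<lambda>(a, b). [a, b]) (zip (fst T) (snd T)))"

text \<open>The permutation acts on \<open>{1..2 * n}\<close>, while list positions start at \<open>0\<close>.\<close>

definition tableau_perm :: "tableau2 \<Rightarrow> nat \<Rightarrow> nat"
  where "tableau_perm T p =
    (if p \<in> {1..length (column_word T)} then column_word T ! (p - 1) else p)"

definition inversions :: "nat \<Rightarrow> (nat \<Rightarrow> nat) \<Rightarrow> (nat \<times> nat) set"
  where "inversions N \<sigma> =
    {(a, b). a > b \<and> (\<exists>p q. 1 \<le> p \<and> p < q \<and> q \<le> N \<and> \<sigma> p = a \<and> \<sigma> q = b)}"

end

theory Submission
  imports Defs "HOL-Combinatorics.Transposition"
begin

text \<open>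
  Call the left endpoint of an arc an opener and its right endpoint a closer. All three quantities
  are governed by a single one: the number of pairs \<open>(r, s)\<close> of an opener \<open>r\<close> and a closer \<open>s\<close>
  with \<open>r < s\<close>.

  It exceeds the nesting number by \<open>n * (n + 1) div 2\<close>. Indeed, for a closer \<open>s\<close> the openers to
  its left belong either to arcs that are still open at \<open>s\<close>, and these are the arcs above the
  one that ends in \<open>s\<close>, or to arcs that are closed at \<open>s\<close>, among them the one that ends
  in \<open>s\<close>; as the closers are linearly ordered, the latter contribute \<open>1 + 2 + \<dots> + n\<close> (lemma \<open>ordered_pairs_nesting_number\<close>).

  It also exceeds the number of inversions by \<open>n * (n + 1) div 2\<close>. The rows of the tableau are
  the openers and the closers in increasing order; conversely these rows form a tableau whose web
  is \<open>w\<close>, since each closer is joined to the nearest vertex that is still unmatched (lemma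
  \<open>tableau_web_surj\<close>). An inversion of the column word consists of
  a closer and a smaller opener in a later column. A closer is larger than all the openers in its
  own and earlier columns, and those again contribute \<open>1 + 2 + \<dots> + n\<close> (lemma
  \<open>ordered_pairs_inversions\<close>).

  Finally, an edge of the web graph turns adjacent vertices \<open>i\<close>, \<open>i + 1\<close> that are a closer
  and an opener into an opener and a closer, which creates exactly one pair. So every edge raises the
  nesting number by \<open>1\<close> (lemma \<open>nesting_number_web_edge\<close>), and since it is \<open>0\<close> for the web
  \<open>web0 n\<close>, every path from there to \<open>w\<close> has length \<open>nesting_number w\<close>. A path exists,
  because every other web has a predecessor in the graph (lemma \<open>web_edge_predecessor\<close>).
\<close>

section \<open>Noncrossing perfect matchings\<close>

text \<open>Unique coverage of the vertices splits into two parts that are easier to use separately: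
  every vertex is covered, and two arcs that share an endpoint are equal.\<close>

lemma webs_iff:
  "w \<in> webs n \<longleftrightarrow>
    (\<forall>i j. (i, j) \<in> w \<longrightarrow> 1 \<le> i \<and> i < j \<and> j \<le> 2 * n) \<and>
    (\<forall>v. 1 \<le> v \<and> v \<le> 2 * n \<longrightarrow> v \<in> fst ` w \<union> snd ` w) \<and>
    (\<forall>a \<in> w. \<forall>b \<in> w. {fst a, snd a} \<inter> {fst b, snd b} \<noteq> {} \<longrightarrow> a = b) \<and>
    (\<forall>i j k l. (i, j) \<in> w \<and> (k, l) \<in> w \<longrightarrow> \<not> (i < k \<and> k < j \<and> j < l))"
    (is "_ \<longleftrightarrow> ?rng \<and> ?cov \<and> ?uniq \<and> ?nc")
proof
  assume w: "w \<in> webs n"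
  then have rng: ?rng by (auto simp: webs_def)
  have ex1: "\<exists>!a. a \<in> w \<and> (v = fst a \<or> v = snd a)" if "1 \<le> v" "v \<le> 2 * n" for v
    using w that by (simp add: webs_def)
  have ?cov using ex1 by blast
  moreover have ?uniq
  proof (intro ballI impI)
    fix a b assume ab: "a \<in> w" "b \<in> w" "{fst a, snd a} \<inter> {fst b, snd b} \<noteq> {}"
    then obtain v where v: "v = fst a \<or> v = snd a" "v = fst b \<or> v = snd b" by blast
    have "1 \<le> fst a \<and> fst a < snd a \<and> snd a \<le> 2 * n" using rng ab(1) by (cases a) auto
    then have "1 \<le> v" "v \<le> 2 * n" using v by auto
    from ex1[OF this] v ab show "a = b" by blast
  qed
  moreover have ?nc
  proof (intro allI impI)
    fix i j k l assume a: "(i, j) \<in> w \<and> (k, l) \<in> w"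
    have "\<forall>a \<in> w. \<forall>b \<in> w. \<not> (fst a < fst b \<and> fst b < snd a \<and> snd a < snd b)"
      using w by (simp add: webs_def case_prod_beta)
    then show "\<not> (i < k \<and> k < j \<and> j < l)" using a by (metis fst_conv snd_conv)
  qed
  ultimately show "?rng \<and> ?cov \<and> ?uniq \<and> ?nc" using rng by blast
next
  assume R: "?rng \<and> ?cov \<and> ?uniq \<and> ?nc"
  have "\<exists>!a. a \<in> w \<and> (v = fst a \<or> v = snd a)" if "v \<in> {1..2 * n}" for v
  proof -
    have "v \<in> fst ` w \<union> snd ` w" using R that by simp
    then obtain a where a: "a \<in> w" "v = fst a \<or> v = snd a" by blast
    moreover have "b = a" if "b \<in> w" "v = fst b \<or> v = snd b" for b
    proof -
      have "{fst b, snd b} \<inter> {fst a, snd a} \<noteq> {}" using a that by auto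
      then show ?thesis using R a(1) that(1) by blast
    qed
    ultimately show ?thesis by blast
  qed
  moreover have "\<forall>a \<in> w. 1 \<le> fst a \<and> fst a < snd a \<and> snd a \<le> 2 * n"
    using R by (metis prod.collapse)
  moreover have "\<forall>a \<in> w. \<forall>b \<in> w. \<not> (fst a < fst b \<and> fst b < snd a \<and> snd a < snd b)"
    using R by (metis prod.collapse)
  ultimately show "w \<in> webs n" unfolding webs_def by (simp add: case_prod_beta)
qed

context
  fixes n :: nat and w :: web
  assumes w: "w \<in> webs n"
begin

lemma arc_bounds: "(i, j) \<in> w \<Longrightarrow> 1 \<le> i \<and> i < j \<and> j \<le> 2 * n"
  using w[unfolded webs_iff, THEN conjunct1] by (elim allE impE) auto

lemma vertex_covered: "1 \<le> v \<Longrightarrow> v \<le> 2 * n \<Longrightarrow> v \<in> fst ` w \<union> snd ` w"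
  using w[unfolded webs_iff, THEN conjunct2, THEN conjunct1] by (elim allE impE) auto

lemma arc_unique:
  "a \<in> w \<Longrightarrow> b \<in> w \<Longrightarrow> {fst a, snd a} \<inter> {fst b, snd b} \<noteq> {} \<Longrightarrow> a = b"
  using w[unfolded webs_iff, THEN conjunct2, THEN conjunct2, THEN conjunct1] by (elim ballE impE) auto

lemma arcs_noncrossing: "(i, j) \<in> w \<Longrightarrow> (k, l) \<in> w \<Longrightarrow> i < k \<Longrightarrow> k < j \<Longrightarrow> l \<le> j"
  using w[unfolded webs_iff, THEN conjunct2, THEN conjunct2, THEN conjunct2] by (meson not_le)

lemma same_arc:
  assumes "(i, j) \<in> w" "(k, l) \<in> w" "i = k \<or> i = l \<or> j = k \<or> j = l"
  shows "i = k \<and> j = l"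
  using arc_unique[OF assms(1,2)] assms(3) by auto

lemma distinct_arcs_apart:
  assumes "(i, j) \<in> w" "(k, l) \<in> w" "(i, j) \<noteq> (k, l)"
  shows "i \<noteq> k" "i \<noteq> l" "j \<noteq> k" "j \<noteq> l"
  using same_arc[OF assms(1,2)] assms(3) by blast+

lemma finite_web: "finite w"
proof (rule finite_subset)
  show "w \<subseteq> {1..2 * n} \<times> {1..2 * n}"
  proof
    fix a assume "a \<in> w"
    then show "a \<in> {1..2 * n} \<times> {1..2 * n}"
      using arc_bounds[of "fst a" "snd a"] by (simp add: mem_Times_iff)
  qed
qed simp

lemma inj_on_opener: "inj_on fst w"
  by (rule inj_onI, rule arc_unique) simp_all

lemma inj_on_closer: "inj_on snd w"
  by (rule inj_onI, rule arc_unique) simp_all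

lemma openers_closers_disjoint: "fst ` w \<inter> snd ` w = {}"
proof -
  have "fst a \<noteq> snd b" if "a \<in> w" "b \<in> w" for a b
  proof
    assume eq: "fst a = snd b"
    then have "a = b" using arc_unique[OF that] by simp
    moreover have "fst b < snd b" using arc_bounds[of "fst b" "snd b"] that by simp
    ultimately show False using eq by simp
  qed
  then show ?thesis by blast
qed

lemma openers_closers_cover: "fst ` w \<union> snd ` w = {1..2 * n}"
proof
  have "fst a \<in> {1..2 * n} \<and> snd a \<in> {1..2 * n}" if "a \<in> w" for a
    using arc_bounds[of "fst a" "snd a"] that by simp
  then show "fst ` w \<union> snd ` w \<subseteq> {1..2 * n}" by blast
  show "{1..2 * n} \<subseteq> fst ` w \<union> snd ` w"
    using vertex_covered by (simp add: subset_iff)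
qed

lemma card_web: "card w = n"
proof -
  have "card (fst ` w \<union> snd ` w) = card (fst ` w) + card (snd ` w)"
    using openers_closers_disjoint finite_web by (simp add: card_Un_disjoint)
  then show ?thesis
    using openers_closers_cover card_image[OF inj_on_opener] card_image[OF inj_on_closer] by simp
qed

lemma partner_eq:
  assumes "(i, j) \<in> w"
  shows "partner w i = j" "partner w j = i"
proof -
  show "partner w i = j"
    unfolding partner_def
  proof (rule the_equality)
    show "u = j" if "(u, i) \<in> w \<or> (i, u) \<in> w" for u
      using that same_arc[OF assms, of u i] same_arc[OF assms, of i u] by auto
  qed (use assms in simp)
  show "partner w j = i"
    unfolding partner_def
  proof (rule the_equality)
    show "u = i" if "(u, j) \<in> w \<or> (j, u) \<in> w" for u
      using that same_arc[OF assms, of u j] same_arc[OF assms, of j u] by auto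
  qed (use assms in simp)
qed

end

section \<open>Counting openers before closers\<close>

lemma twice_card_weakly_ordered_pairs:
  fixes C :: "'a::linorder set"
  assumes "finite C"
  shows "2 * card {(x, y). x \<in> C \<and> y \<in> C \<and> x \<le> y} = card C * (card C + 1)"
  using assms
proof (induction C rule: finite_linorder_max_induct)
  case empty
  then show ?case by simp
next
  case (insert m C)
  let ?P = "\<lambda>C. {(x, y). x \<in> C \<and> y \<in> C \<and> x \<le> y}"
  have "?P (insert m C) = ?P C \<union> insert m C \<times> {m}"
    using insert.hyps by (auto simp: not_le)
  moreover have "?P C \<inter> insert m C \<times> {m} = {}" using insert.hyps by auto
  moreover have "finite (?P C)"
    by (rule finite_subset[of _ "C \<times> C"]) (use insert.hyps in auto)
  ultimately have "card (?P (insert m C)) = card (?P C) + card (insert m C)"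
    using insert.hyps by (simp add: card_Un_disjoint card_cartesian_product)
  moreover have "card (insert m C) = Suc (card C)" using insert.hyps by force
  ultimately show ?case using insert.IH by simp
qed

definition ordered_pairs :: "nat set \<Rightarrow> nat set \<Rightarrow> (nat \<times> nat) set"
  where "ordered_pairs A B = {(r, s). r \<in> A \<and> s \<in> B \<and> r < s}"

lemma finite_ordered_pairs: "finite A \<Longrightarrow> finite B \<Longrightarrow> finite (ordered_pairs A B)"
  by (rule finite_subset[of _ "A \<times> B"]) (auto simp: ordered_pairs_def)

lemma nesting_number_eq_card:
  assumes "finite w"
  shows "nesting_number w = card {(a, b). a \<in> w \<and> b \<in> w \<and> nested_beneath a b}"
proof -
  have "{(a, b). a \<in> w \<and> b \<in> w \<and> nested_beneath a b} = (SIGMA a:w. {b \<in> w. nested_beneath a b})"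
    by auto
  then show ?thesis
    using assms by (simp add: nesting_number_def arc_nesting_def)
qed

text \<open>Pair the opener of an arc \<open>b\<close> with the closer of an arc \<open>a\<close>. If the opener comes first, then
  either \<open>b\<close> closes no later than \<open>a\<close>, or \<open>b\<close> is still open when \<open>a\<close> closes; in the latter case
  \<open>a\<close> is nested beneath \<open>b\<close>, because the arcs do not cross. The first alternative occurs for
  half of \<open>n * (n + 1)\<close> pairs, whatever the web.\<close>

lemma ordered_pairs_nesting_number:
  assumes w: "w \<in> webs n"
  shows "2 * card (ordered_pairs (fst ` w) (snd ` w)) = 2 * nesting_number w + n * (n + 1)"
proof -
  let ?N = "{(a, b). a \<in> w \<and> b \<in> w \<and> nested_beneath a b}"
  let ?D = "{(a, b). a \<in> w \<and> b \<in> w \<and> snd b \<le> snd a}"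
  let ?g = "\<lambda>(a, b). (fst b, snd a) :: nat \<times> nat"
  let ?h = "\<lambda>(a, b). (snd b, snd a) :: nat \<times> nat"
  note fin = finite_web[OF w]
  have finND: "finite ?N" "finite ?D"
    by (rule finite_subset[of _ "w \<times> w"]; use fin in auto)+
  have open_iff: "nested_beneath a b \<longleftrightarrow> fst b < snd a \<and> snd a < snd b"
    if "a \<in> w" "b \<in> w" for a b
  proof -
    obtain r s r' s' where [simp]: "a = (r, s)" "b = (r', s')" by fastforce
    show ?thesis
      using that arc_bounds[OF w] arcs_noncrossing[OF w, of r s r' s'] same_arc[OF w, of r s r' s']
      by (fastforce simp: nested_beneath_def)
  qed
  have lt: "fst b < snd b" if "b \<in> w" for b
    using arc_bounds[OF w] that by (cases b) auto
  have pairs: "ordered_pairs (fst ` w) (snd ` w) = ?g ` (?N \<union> ?D)"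
  proof (intro equalityI subsetI)
    fix p assume "p \<in> ordered_pairs (fst ` w) (snd ` w)"
    then obtain a b where ab: "a \<in> w" "b \<in> w" "fst b < snd a" "p = ?g (a, b)"
      by (auto simp: ordered_pairs_def)
    then have "(a, b) \<in> ?N \<union> ?D" using open_iff by auto
    with ab(4) show "p \<in> ?g ` (?N \<union> ?D)" by (rule image_eqI)
  next
    fix p assume "p \<in> ?g ` (?N \<union> ?D)"
    then obtain a b where "a \<in> w" "b \<in> w" "nested_beneath a b \<or> snd b \<le> snd a" "p = (fst b, snd a)"
      by auto
    then show "p \<in> ordered_pairs (fst ` w) (snd ` w)"
      using open_iff lt by (fastforce simp: ordered_pairs_def)
  qed
  have inj_g: "inj_on ?g (w \<times> w)"
    using inj_on_opener[OF w] inj_on_closer[OF w]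
    by (auto simp: inj_on_def)
  have inj_h: "inj_on ?h (w \<times> w)"
    using inj_on_closer[OF w] by (auto simp: inj_on_def)
  have "card (ordered_pairs (fst ` w) (snd ` w)) = card (?N \<union> ?D)"
    unfolding pairs by (rule card_image, rule inj_on_subset[OF inj_g]) auto
  also have "\<dots> = card ?N + card ?D"
    by (rule card_Un_disjoint) (use finND in \<open>auto simp: nested_beneath_def\<close>)
  finally have card_pairs:
    "card (ordered_pairs (fst ` w) (snd ` w)) = nesting_number w + card ?D"
    using nesting_number_eq_card[OF fin] by simp
  have "?h ` ?D = {(x, y). x \<in> snd ` w \<and> y \<in> snd ` w \<and> x \<le> y}"
  proof (intro equalityI subsetI)
    fix p assume "p \<in> {(x, y). x \<in> snd ` w \<and> y \<in> snd ` w \<and> x \<le> y}"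
    then obtain a b where ab: "a \<in> w" "b \<in> w" "snd b \<le> snd a" "p = ?h (a, b)" by auto
    then have "(a, b) \<in> ?D" by simp
    with ab(4) show "p \<in> ?h ` ?D" by (rule image_eqI)
  qed auto
  moreover have "card (?h ` ?D) = card ?D"
    by (rule card_image, rule inj_on_subset[OF inj_h]) auto
  ultimately have "2 * card ?D = card (snd ` w) * (card (snd ` w) + 1)"
    using twice_card_weakly_ordered_pairs[of "snd ` w"] fin by simp
  then show ?thesis
    using card_pairs card_image[OF inj_on_closer[OF w]] card_web[OF w] by simp
qed

text \<open>Exchanging the neighbouring values \<open>i\<close> and \<open>i + 1\<close> preserves the order of any two numbers
  other than these two, which in turn become an additional ordered pair.\<close>

lemma card_ordered_pairs_transpose:
  assumes "finite A" "finite B" "i \<in> B" "i + 1 \<in> A" "i \<notin> A" "i + 1 \<notin> B"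
  shows "card (ordered_pairs (transpose i (i + 1) ` A) (transpose i (i + 1) ` B)) =
    card (ordered_pairs A B) + 1"
proof -
  let ?t = "transpose i (i + 1)"
  let ?tt = "map_prod ?t ?t"
  have mono: "?t r < ?t s \<longleftrightarrow> r < s \<or> (r = i + 1 \<and> s = i)" if "r \<in> A" "s \<in> B" for r s
    using that assms(5,6) by (auto simp: transpose_def)
  have eq: "ordered_pairs (?t ` A) (?t ` B) = insert (i, i + 1) (?tt ` ordered_pairs A B)"
  proof (intro equalityI subsetI)
    fix p assume "p \<in> ordered_pairs (?t ` A) (?t ` B)"
    then obtain r s where rs: "p = (?t r, ?t s)" "r \<in> A" "s \<in> B" "?t r < ?t s"
      by (auto simp: ordered_pairs_def)
    show "p \<in> insert (i, i + 1) (?tt ` ordered_pairs A B)"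
    proof (cases "r < s")
      case True
      with rs have "(r, s) \<in> ordered_pairs A B" by (simp add: ordered_pairs_def)
      moreover have "p = ?tt (r, s)" using rs(1) by simp
      ultimately show ?thesis by blast
    next
      case False
      then show ?thesis using rs mono by auto
    qed
  next
    fix p assume "p \<in> insert (i, i + 1) (?tt ` ordered_pairs A B)"
    then consider "p = (i, i + 1)" | r s where "p = (?t r, ?t s)" "r \<in> A" "s \<in> B" "r < s"
      by (auto simp: ordered_pairs_def)
    then show "p \<in> ordered_pairs (?t ` A) (?t ` B)"
    proof cases
      case 1
      have "i \<in> ?t ` A" "i + 1 \<in> ?t ` B"
        using assms(3,4) by (metis image_eqI transpose_apply_first transpose_apply_second)+
      then show ?thesis using 1 by (simp add: ordered_pairs_def)
    qed (use mono in \<open>auto simp: ordered_pairs_def\<close>)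
  qed
  have new: "(i, i + 1) \<notin> ?tt ` ordered_pairs A B"
  proof
    assume "(i, i + 1) \<in> ?tt ` ordered_pairs A B"
    then obtain r s where "i = ?t r" "i + 1 = ?t s" "r < s" by (auto simp: ordered_pairs_def)
    then show False by (auto simp: transpose_def split: if_splits)
  qed
  have "inj ?tt" by (simp add: prod.inj_map)
  then show ?thesis
    unfolding eq using new finite_ordered_pairs[OF assms(1,2)]
    by (simp add: card_image inj_on_subset)
qed

section \<open>Paths in the web graph\<close>

lemma basis_vec_inject: "basis_vec u = basis_vec v \<longleftrightarrow> u = v"
  unfolding basis_vec_def by (metis lookup_single_eq lookup_single_not_eq zero_neq_one)

lemma reconnect_eq:
  assumes w: "w \<in> webs n" and "(j, i) \<in> w" "(i + 1, k) \<in> w"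
  shows "reconnect i w = w - {(j, i), (i + 1, k)} \<union> {(i, i + 1), (j, k)}"
proof -
  have "j < i" "i + 1 < k" using arc_bounds[OF w] assms(2,3) by blast+
  then show ?thesis
    using partner_eq[OF w assms(2)] partner_eq[OF w assms(3)]
    by (simp add: reconnect_def arc_of_def)
qed

text \<open>Distinct webs are distinct basis vectors, so \<open>s\<^sub>i w = w + w'\<close> determines \<open>w'\<close>.\<close>

lemma web_edge_iff:
  "web_edge n i w w' \<longleftrightarrow> w \<in> webs n \<and> w' \<in> webs n \<and>
    (\<exists>j k. (j, i) \<in> w \<and> (i + 1, k) \<in> w \<and>
      w' = w - {(j, i), (i + 1, k)} \<union> {(i, i + 1), (j, k)})"
proof (cases "w \<in> webs n")
  case w: True
  have *: "s_act i (basis_vec w) = basis_vec w + basis_vec w' \<longleftrightarrow>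
      w' = w - {(j, i), (i + 1, k)} \<union> {(i, i + 1), (j, k)}"
    "1 \<le> i" "i + 1 \<le> 2 * n" "j < i" "i + 1 < k"
    if jk: "(j, i) \<in> w" "(i + 1, k) \<in> w" for j k
  proof -
    show b: "1 \<le> i" "i + 1 \<le> 2 * n" "j < i" "i + 1 < k"
      using arc_bounds[OF w] jk by force+
    have "(i, i + 1) \<notin> w" using same_arc[OF w _ jk(1), of i "i + 1"] b by auto
    then show "s_act i (basis_vec w) = basis_vec w + basis_vec w' \<longleftrightarrow>
        w' = w - {(j, i), (i + 1, k)} \<union> {(i, i + 1), (j, k)}"
      using reconnect_eq[OF w jk] by (auto simp: s_act_basis_vec s_basis_def basis_vec_inject)
  qed
  show ?thesis unfolding web_edge_def using w * by metis
qed (simp add: web_edge_def)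

text \<open>Along an edge the closer \<open>i\<close> becomes an opener and the opener \<open>i + 1\<close> a closer, while all other
  vertices keep their kind. So the sets of openers and closers change by a transposition.\<close>

lemma nesting_number_web_edge:
  assumes "web_edge n i w w'"
  shows "nesting_number w' = nesting_number w + 1"
proof -
  obtain j k where w: "w \<in> webs n" and w': "w' \<in> webs n"
    and jk: "(j, i) \<in> w" "(i + 1, k) \<in> w"
    and eq: "w' = w - {(j, i), (i + 1, k)} \<union> {(i, i + 1), (j, k)}"
    using assms unfolding web_edge_iff by blast
  let ?t = "transpose i (i + 1)"
  have lt: "j < i" "i + 1 < k" using arc_bounds[OF w jk(1)] arc_bounds[OF w jk(2)] by simp_all
  have other: "?t (fst a) = fst a" "?t (snd a) = snd a" if "a \<in> w - {(j, i), (i + 1, k)}" for a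
  proof -
    obtain r s where [simp]: "a = (r, s)" by (cases a)
    have rs: "(r, s) \<in> w" "(r, s) \<noteq> (j, i)" "(r, s) \<noteq> (i + 1, k)" using that by simp_all
    show "?t (fst a) = fst a" "?t (snd a) = snd a"
      using distinct_arcs_apart[OF w rs(1) jk(1) rs(2)] distinct_arcs_apart[OF w rs(1) jk(2) rs(3)]
      by (simp_all add: transpose_apply_other)
  qed
  let ?R = "w - {(j, i), (i + 1, k)}"
  have dec: "w = ?R \<union> {(j, i), (i + 1, k)}" using jk by blast
  have "fst ` ?R = ?t ` fst ` ?R"
    unfolding image_image using other by (intro image_cong refl) simp
  moreover have "fst ` {(i, i + 1), (j, k)} = ?t ` fst ` {(j, i), (i + 1, k)}"
    using lt by (simp add: transpose_def insert_commute)
  ultimately have fst': "fst ` w' = ?t ` fst ` w"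
    by (subst dec, unfold eq image_Un) simp
  have "snd ` ?R = ?t ` snd ` ?R"
    unfolding image_image using other by (intro image_cong refl) simp
  moreover have "snd ` {(i, i + 1), (j, k)} = ?t ` snd ` {(j, i), (i + 1, k)}"
    using lt by (simp add: transpose_def insert_commute)
  ultimately have snd': "snd ` w' = ?t ` snd ` w"
    by (subst dec, unfold eq image_Un) simp
  have "i \<in> snd ` w" "i + 1 \<in> fst ` w" using jk by force+
  moreover from this have "i \<notin> fst ` w" "i + 1 \<notin> snd ` w"
    using openers_closers_disjoint[OF w] by blast+
  ultimately have "card (ordered_pairs (fst ` w') (snd ` w')) =
      card (ordered_pairs (fst ` w) (snd ` w)) + 1"
    unfolding fst' snd' using finite_web[OF w]
    by (intro card_ordered_pairs_transpose) auto
  then show ?thesis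
    using ordered_pairs_nesting_number[OF w] ordered_pairs_nesting_number[OF w'] by simp
qed

lemma nesting_number_web0: "nesting_number (web0 n) = 0"
proof -
  have "{b \<in> web0 n. nested_beneath a b} = {}" for a
    by (auto simp: web0_def nested_beneath_def)
  then show ?thesis by (simp only: nesting_number_def arc_nesting_def) simp
qed

lemma web_path_length:
  assumes "(web0 n, w) \<in> web_graph n ^^ k"
  shows "k = nesting_number w"
  using assms
proof (induction k arbitrary: w)
  case 0
  then have "w = web0 n" by simp
  then show ?case by (simp add: nesting_number_web0)
next
  case (Suc k)
  then obtain u i where "(web0 n, u) \<in> web_graph n ^^ k" "web_edge n i u w"
    by (auto simp: web_graph_def)
  then show ?case using Suc.IH nesting_number_web_edge by fastforce
qed

text \<open>If all arcs have length \<open>1\<close>, then from left to right each vertex that is not yet matched has to be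
  joined to its right neighbour.\<close>

lemma web_eq_web0:
  assumes w: "w \<in> webs n" and short: "\<And>j k. (j, k) \<in> w \<Longrightarrow> k = j + 1"
  shows "w = web0 n"
proof -
  have base: "(2 * m + 1, 2 * m + 2) \<in> w" if "m < n" for m
    using that
  proof (induction m)
    case 0
    then have "1 \<in> fst ` w \<union> snd ` w" using vertex_covered[OF w] by simp
    then obtain j k where jk: "(j, k) \<in> w" "1 = j \<or> 1 = k" by force
    then show ?case using short[OF jk(1)] arc_bounds[OF w jk(1)] by auto
  next
    case (Suc m)
    then have "2 * Suc m + 1 \<in> fst ` w \<union> snd ` w" using vertex_covered[OF w] by simp
    then obtain j k where jk: "(j, k) \<in> w" "2 * Suc m + 1 = j \<or> 2 * Suc m + 1 = k" by force
    have "k = j + 1" using short jk by blast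
    moreover have "j \<noteq> 2 * m + 2"
      using same_arc[OF w jk(1), of "2 * m + 1" "2 * m + 2"] Suc by auto
    ultimately show ?case using jk by auto
  qed
  have sub: "web0 n \<subseteq> w"
  proof
    fix a assume "a \<in> web0 n"
    then obtain m where m: "a = (2 * m - 1, 2 * m)" "1 \<le> m" "m \<le> n" by (auto simp: web0_def)
    then obtain m' where "m = Suc m'" by (cases m) auto
    then show "a \<in> w" using base[of m'] m by simp
  qed
  have "card (web0 n) = n"
  proof -
    have "web0 n = (\<lambda>m. (2 * m - 1, 2 * m)) ` {1..n}" by (auto simp: web0_def)
    moreover have "inj_on (\<lambda>m. (2 * m - 1, 2 * m) :: nat \<times> nat) {1..n}"
      by (auto simp: inj_on_def)
    ultimately show ?thesis by (simp add: card_image)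
  qed
  then show ?thesis
    using sub card_web[OF w] finite_web[OF w] card_subset_eq by metis
qed

text \<open>Take the rightmost opener \<open>j\<close> of an arc longer than \<open>1\<close>. The vertex \<open>j + 1\<close> lies beneath that
  arc, so it must be an opener, and its arc has length \<open>1\<close> by the choice of \<open>j\<close>. Separating these two
  arcs undoes an edge of the web graph.\<close>

lemma web_edge_predecessor:
  assumes w: "w \<in> webs n" and "w \<noteq> web0 n"
  obtains u i where "web_edge n i u w"
proof -
  let ?L = "{j. \<exists>k. (j, k) \<in> w \<and> k \<noteq> j + 1}"
  have "?L \<noteq> {}" using web_eq_web0[OF w] assms(2) by blast
  moreover have "finite ?L"
    by (rule finite_subset[of _ "fst ` w"]) (use finite_web[OF w] in force)+
  ultimately have "Max ?L \<in> ?L" and max: "\<And>j. j \<in> ?L \<Longrightarrow> j \<le> Max ?L"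
    using Max_in by auto
  then obtain j k where j: "j = Max ?L" and jk: "(j, k) \<in> w" "k \<noteq> j + 1" by blast
  have jk_lt: "1 \<le> j" "j + 1 < k" "k \<le> 2 * n" using arc_bounds[OF w jk(1)] jk(2) by auto
  have "j + 1 \<in> fst ` w \<union> snd ` w" using vertex_covered[OF w] jk_lt by simp
  moreover have "j + 1 \<notin> snd ` w"
  proof
    assume "j + 1 \<in> snd ` w"
    then obtain r where r: "(r, j + 1) \<in> w" by force
    then have "r < j" using arc_bounds[OF w r] same_arc[OF w r jk(1)] jk(2) by (cases "r = j") auto
    then show False using arcs_noncrossing[OF w r jk(1)] jk_lt by simp
  qed
  ultimately obtain l where l: "(j + 1, l) \<in> w" by force
  have inner: "(j + 1, j + 2) \<in> w"
  proof -
    have "j + 1 \<notin> ?L" using max[of "j + 1"] j by auto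
    then show ?thesis using l by auto
  qed
  have "j + 2 < k"
    using arcs_noncrossing[OF w jk(1) inner] jk_lt same_arc[OF w jk(1) inner] by force
  let ?R = "w - {(j, k), (j + 1, j + 2)}"
  let ?u = "?R \<union> {(j, j + 1), (j + 2, k)}"
  have apart: "r \<notin> {j, j + 1, j + 2, k} \<and> s \<notin> {j, j + 1, j + 2, k}" if "(r, s) \<in> ?R" for r s
  proof -
    have rs: "(r, s) \<in> w" "(r, s) \<noteq> (j, k)" "(r, s) \<noteq> (j + 1, j + 2)" using that by blast+
    show ?thesis
      using distinct_arcs_apart[OF w rs(1) jk(1) rs(2)] distinct_arcs_apart[OF w rs(1) inner rs(3)]
      by simp
  qed
  have "?u \<in> webs n"
    unfolding webs_iff
  proof (intro conjI)
    show "\<forall>r s. (r, s) \<in> ?u \<longrightarrow> 1 \<le> r \<and> r < s \<and> s \<le> 2 * n"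
    proof (intro allI impI)
      fix r s assume "(r, s) \<in> ?u"
      then consider "(r, s) \<in> w" | "(r, s) = (j, j + 1)" | "(r, s) = (j + 2, k)" by blast
      then show "1 \<le> r \<and> r < s \<and> s \<le> 2 * n"
        using arc_bounds[OF w, of r s] jk_lt \<open>j + 2 < k\<close> by cases simp_all
    qed
    have "fst ` w \<union> snd ` w \<subseteq> fst ` ?u \<union> snd ` ?u"
    proof
      fix v assume "v \<in> fst ` w \<union> snd ` w"
      then obtain a where a: "a \<in> w" "v = fst a \<or> v = snd a" by blast
      show "v \<in> fst ` ?u \<union> snd ` ?u"
      proof (cases "a \<in> ?R")
        case True
        then show ?thesis using a(2) by blast
      next
        case False
        then have "v \<in> {j, j + 1, j + 2, k}" using a by auto
        then show ?thesis by auto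
      qed
    qed
    then show "\<forall>v. 1 \<le> v \<and> v \<le> 2 * n \<longrightarrow> v \<in> fst ` ?u \<union> snd ` ?u"
      unfolding openers_closers_cover[OF w] by (simp add: subset_iff)
    show "\<forall>a\<in>?u. \<forall>b\<in>?u. {fst a, snd a} \<inter> {fst b, snd b} \<noteq> {} \<longrightarrow> a = b"
    proof (intro ballI impI)
      fix a b assume ab: "a \<in> ?u" "b \<in> ?u" "{fst a, snd a} \<inter> {fst b, snd b} \<noteq> {}"
      let ?V = "{j, j + 1, j + 2, k}"
      have old: "{fst c, snd c} \<inter> ?V = {}" if "c \<in> ?R" for c
        using apart[of "fst c" "snd c"] that by simp
      have new: "{fst c, snd c} \<subseteq> ?V" if "c \<in> {(j, j + 1), (j + 2, k)}" for c
        using that by auto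
      show "a = b"
      proof (cases "a \<in> ?R")
        case True
        then have "b \<in> ?R" using ab(2,3) old[of a] new[of b] by blast
        then show ?thesis using True ab(3) arc_unique[OF w, of a b] by blast
      next
        case False
        then have a: "a \<in> {(j, j + 1), (j + 2, k)}" using ab(1) by blast
        then have "b \<in> {(j, j + 1), (j + 2, k)}" using ab(2,3) old[of b] new[of a] by blast
        then show ?thesis using a ab(3) \<open>j + 2 < k\<close> by auto
      qed
    qed
    show "\<forall>r s r' s'. (r, s) \<in> ?u \<and> (r', s') \<in> ?u \<longrightarrow> \<not> (r < r' \<and> r' < s \<and> s < s')"
    proof (intro allI impI notI)
      fix r s r' s'
      assume u: "(r, s) \<in> ?u \<and> (r', s') \<in> ?u" and cross: "r < r' \<and> r' < s \<and> s < s'"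
      \<comment> \<open>No arc can cross \<open>(j, j + 1)\<close>, and an arc of \<open>w\<close> that crosses \<open>(j + 2, k)\<close> also
        crosses \<open>(j, k)\<close>, because it has no endpoint in \<open>{j, j + 1}\<close>.\<close>
      have new_old: False
        if new: "(r, s) = (j, j + 1) \<or> (r, s) = (j + 2, k)"
          and old: "(r', s') \<in> ?R"
      proof -
        have "(r', s') \<in> w" using old by blast
        then show False
          using new cross arcs_noncrossing[OF w jk(1), of r' s'] by auto
      qed
      have old_new: False
        if old: "(r, s) \<in> ?R"
          and new: "(r', s') = (j, j + 1) \<or> (r', s') = (j + 2, k)"
      proof -
        have rs: "(r, s) \<in> w" using old by blast
        have "r \<noteq> j" "r \<noteq> j + 1" "s \<noteq> j + 1" "s \<noteq> j + 2" "r \<noteq> j + 2" "s \<noteq> k"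
          using apart[OF old] by simp_all
        then show False
          using new cross arcs_noncrossing[OF w rs jk(1)] arcs_noncrossing[OF w jk(1) rs] by auto
      qed
      consider "(r, s) \<in> ?R" "(r', s') \<in> ?R"
        | "(r, s) \<in> ?R" "(r', s') = (j, j + 1) \<or> (r', s') = (j + 2, k)"
        | "(r, s) = (j, j + 1) \<or> (r, s) = (j + 2, k)" "(r', s') \<in> ?R"
        | "(r, s) = (j, j + 1) \<or> (r, s) = (j + 2, k)"
          "(r', s') = (j, j + 1) \<or> (r', s') = (j + 2, k)"
        using u by blast
      then show False
      proof cases
        case 1
        then have "(r, s) \<in> w" "(r', s') \<in> w" by blast+
        then show ?thesis using arcs_noncrossing[OF w, of r s r' s'] cross by simp
      next
        case 2
        then show ?thesis using old_new by blast
      next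
        case 3
        then show ?thesis using new_old by blast
      next
        case 4
        then show ?thesis using cross by auto
      qed
    qed
  qed
  moreover have "w = ?u - {(j, j + 1), (j + 2, k)} \<union> {(j + 1, j + 2), (j, k)}"
  proof -
    have "(j, j + 1) \<notin> w" "(j + 2, k) \<notin> w"
      using same_arc[OF w _ jk(1), of j "j + 1"] same_arc[OF w _ jk(1), of "j + 2" k] jk(2) by auto
    then show ?thesis using jk(1) inner by blast
  qed
  moreover have "(j, j + 1) \<in> ?u" "(j + 1 + 1, k) \<in> ?u" by simp_all
  moreover have "j + 1 + 1 = j + 2" by simp
  ultimately have "web_edge n (j + 1) ?u w"
    unfolding web_edge_iff using w by metis
  then show ?thesis using that by blast
qed

lemma web_path_exists:
  assumes "w \<in> webs n"
  shows "(web0 n, w) \<in> web_graph n ^^ nesting_number w"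
  using assms
proof (induction "nesting_number w" arbitrary: w rule: less_induct)
  case less
  show ?case
  proof (cases "w = web0 n")
    case True
    then show ?thesis by (simp add: nesting_number_web0)
  next
    case False
    then obtain u i where ui: "web_edge n i u w" using web_edge_predecessor[OF less.prems] by blast
    then have nest: "nesting_number w = Suc (nesting_number u)"
      using nesting_number_web_edge by fastforce
    have "u \<in> webs n" using ui by (simp add: web_edge_def)
    then have "(web0 n, u) \<in> web_graph n ^^ nesting_number u" using less.hyps nest by simp
    moreover have "(u, w) \<in> web_graph n" using ui by (auto simp: web_graph_def)
    ultimately show ?thesis unfolding nest by auto
  qed
qed

lemma web_dist_eq_nesting_number:
  assumes "w \<in> webs n"
  shows "web_dist n (web0 n) w = enat (nesting_number w)"
proof -
  have "{k. (web0 n, w) \<in> web_graph n ^^ k} = {nesting_number w}"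
    using web_path_exists[OF assms] web_path_length by blast
  then show ?thesis by (simp add: web_dist_def)
qed

section \<open>Inversions of a tableau\<close>

lemma length_interleave:
  "length xs = length ys \<Longrightarrow> length (concat (map (\<lambda>(a, b). [a, b]) (zip xs ys))) = 2 * length xs"
  by (induction xs ys rule: list_induct2) auto

lemma nth_interleave:
  assumes "length xs = length ys" "m < length xs"
  shows "concat (map (\<lambda>(a, b). [a, b]) (zip xs ys)) ! (2 * m) = xs ! m"
    and "concat (map (\<lambda>(a, b). [a, b]) (zip xs ys)) ! Suc (2 * m) = ys ! m"
  using assms
proof (induction xs ys arbitrary: m rule: list_induct2)
  case (Cons x xs y ys)
  {
    case 1
    then show ?case using Cons.IH(1) by (cases m) simp_all
  next
    case 2
    then show ?case using Cons.IH(2) by (cases m) simp_all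
  }
qed simp_all

text \<open>Rows and columns of a tableau increase, so only a bottom entry can be larger than an entry
  to its right in the column word, which must then be a top entry of a later column.\<close>

lemma inversions_tableau_perm:
  assumes T: "(t, b) \<in> SYT2 n"
  shows "inversions (2 * n) (tableau_perm (t, b)) =
    {(b ! m, t ! l) | m l. m < l \<and> l < n \<and> t ! l < b ! m}"
proof -
  have len: "length t = n" "length b = n" and col: "\<And>m. m < n \<Longrightarrow> t ! m < b ! m"
    and st: "sorted_wrt (<) t" and sb: "sorted_wrt (<) b"
    using T by (auto simp: SYT2_def)
  have t_mono: "t ! l < t ! m" if "l < m" "m < n" for l m
    using sorted_wrt_nth_less[OF st] that len by simp
  have b_mono: "b ! l < b ! m" if "l < m" "m < n" for l m
    using sorted_wrt_nth_less[OF sb] that len by simp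
  let ?c = "column_word (t, b)"
  have len_c: "length ?c = 2 * n" using length_interleave[of t b] len by (simp add: column_word_def)
  have even_c: "?c ! (2 * m) = t ! m" and odd_c: "?c ! Suc (2 * m) = b ! m" if "m < n" for m
    using nth_interleave[of t b m] len that by (simp_all add: column_word_def)
  have perm: "tableau_perm (t, b) (Suc p) = ?c ! p" if "p < 2 * n" for p
    using that len_c by (simp add: tableau_perm_def)
  show ?thesis
  proof (intro equalityI subsetI)
    fix z assume "z \<in> inversions (2 * n) (tableau_perm (t, b))"
    then obtain x y p q where z: "z = (x, y)" "y < x" and pq: "1 \<le> p" "p < q" "q \<le> 2 * n"
      and xy: "tableau_perm (t, b) p = x" "tableau_perm (t, b) q = y"
      by (auto simp: inversions_def)
    obtain p' q' where p': "p = Suc p'" and q': "q = Suc q'" and lt: "p' < q'" "q' < 2 * n"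
      using pq by (cases p; cases q) auto
    have x: "x = ?c ! p'" and y: "y = ?c ! q'" using xy perm p' q' lt by auto
    obtain m where m: "p' = 2 * m \<or> p' = Suc (2 * m)" by (metis oddE evenE Suc_eq_plus1)
    obtain l where l: "q' = 2 * l \<or> q' = Suc (2 * l)" by (metis oddE evenE Suc_eq_plus1)
    have ml: "m \<le> l" "l < n" "m < n" using m l lt by auto
    have t_le: "t ! m \<le> t ! l" using t_mono[of m l] ml by (cases "m = l") auto
    have "p' \<noteq> 2 * m"
    proof
      assume "p' = 2 * m"
      then have "x = t ! m" using x even_c ml by simp
      moreover have "y = t ! l \<or> y = b ! l" using y l even_c odd_c ml by auto
      ultimately show False using t_le col[of l] ml z(2) by auto
    qed
    then have xb: "x = b ! m" and p'': "p' = Suc (2 * m)" using m x odd_c ml by auto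
    have "q' \<noteq> Suc (2 * l)"
    proof
      assume q'': "q' = Suc (2 * l)"
      then have "y = b ! l" "m < l" using y odd_c ml p'' lt by auto
      then show False using xb z(2) b_mono[of m l] ml by simp
    qed
    then have "y = t ! l" "m < l" using l y even_c ml p'' lt by auto
    then show "z \<in> {(b ! m, t ! l) | m l. m < l \<and> l < n \<and> t ! l < b ! m}"
      using z xb ml by blast
  next
    fix z assume "z \<in> {(b ! m, t ! l) | m l. m < l \<and> l < n \<and> t ! l < b ! m}"
    then obtain m l where z: "z = (b ! m, t ! l)" and ml: "m < l" "l < n" "t ! l < b ! m" by blast
    have "tableau_perm (t, b) (Suc (Suc (2 * m))) = b ! m"
      using perm[of "Suc (2 * m)"] odd_c[of m] ml by simp
    moreover have "tableau_perm (t, b) (Suc (2 * l)) = t ! l"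
      using perm[of "2 * l"] even_c[of l] ml by simp
    moreover have "1 \<le> Suc (Suc (2 * m))" "Suc (Suc (2 * m)) < Suc (2 * l)" "Suc (2 * l) \<le> 2 * n"
      using ml by auto
    ultimately show "z \<in> inversions (2 * n) (tableau_perm (t, b))"
      unfolding inversions_def z using ml(3) by blast
  qed
qed

text \<open>Among the pairs of a top entry smaller than a bottom entry, those whose bottom entry lies in a
  strictly earlier column are the inversions. The others are all the pairs whose top entry lies
  in the same column or further left: there are half of \<open>n * (n + 1)\<close> of these, whatever the
  tableau.\<close>

lemma ordered_pairs_inversions:
  assumes T: "(t, b) \<in> SYT2 n"
  shows "2 * card (ordered_pairs (set t) (set b)) =
    2 * card (inversions (2 * n) (tableau_perm (t, b))) + n * (n + 1)"
proof -
  have len: "length t = n" "length b = n" and col: "\<And>m. m < n \<Longrightarrow> t ! m < b ! m"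
    and st: "sorted_wrt (<) t" and dist: "distinct t" "distinct b"
    using T by (auto simp: SYT2_def)
  have t_less_b: "t ! l < b ! m" if "l \<le> m" "m < n" for l m
    using sorted_wrt_nth_less[OF st, of l m] col[of m] that len by (cases "l = m") auto
  let ?I = "{(l, m). m < l \<and> l < n \<and> t ! l < b ! m}"
  let ?J = "{(l, m). l \<in> {..<n} \<and> m \<in> {..<n} \<and> l \<le> m}"
  let ?g = "\<lambda>(l, m). (t ! l, b ! m)"
  let ?h = "\<lambda>(l, m). (b ! m, t ! l)"
  have inj: "inj_on ?g ({..<n} \<times> {..<n})" "inj_on ?h ({..<n} \<times> {..<n})"
    using dist len by (auto simp: inj_on_def nth_eq_iff_index_eq)
  have fin: "finite ?I" "finite ?J"
    by (rule finite_subset[of _ "{..<n} \<times> {..<n}"]; force)+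
  have "ordered_pairs (set t) (set b) = ?g ` (?I \<union> ?J)"
  proof (intro equalityI subsetI)
    fix p assume "p \<in> ordered_pairs (set t) (set b)"
    then obtain l m where lm: "p = ?g (l, m)" "l < n" "m < n" "t ! l < b ! m"
      using len by (auto simp: ordered_pairs_def in_set_conv_nth)
    then have "(l, m) \<in> ?I \<union> ?J" by auto
    with lm(1) show "p \<in> ?g ` (?I \<union> ?J)" by (rule image_eqI)
  next
    fix p assume "p \<in> ?g ` (?I \<union> ?J)"
    then obtain l m where "p = (t ! l, b ! m)" "l < n" "m < n" "t ! l < b ! m"
      using t_less_b by auto
    then show "p \<in> ordered_pairs (set t) (set b)" using len by (simp add: ordered_pairs_def)
  qed
  then have "card (ordered_pairs (set t) (set b)) = card (?I \<union> ?J)"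
    by (simp only:) (rule card_image, rule inj_on_subset[OF inj(1)], auto)
  also have "\<dots> = card ?I + card ?J"
    by (rule card_Un_disjoint) (use fin in auto)
  also have "card ?I = card (inversions (2 * n) (tableau_perm (t, b)))"
  proof -
    have "inversions (2 * n) (tableau_perm (t, b)) = ?h ` ?I"
      unfolding inversions_tableau_perm[OF T] by (auto simp: image_iff)
    moreover have "card (?h ` ?I) = card ?I"
      by (rule card_image, rule inj_on_subset[OF inj(2)]) auto
    ultimately show ?thesis by simp
  qed
  finally show ?thesis
    using twice_card_weakly_ordered_pairs[of "{..<n}"] by simp
qed

section \<open>Every web comes from a tableau\<close>

lemma closers_fold_join_left: "snd ` fold join_left vs w = set vs \<union> snd ` w"
  by (induction vs arbitrary: w) (auto simp: join_left_def)

text \<open>When the closer \<open>v\<close> is processed, every vertex beneath its arc \<open>(r, v)\<close> has been matched,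
  because its own arc lies beneath \<open>(r, v)\<close> too. So \<open>r\<close> is the nearest unmatched vertex.\<close>

lemma join_left_web:
  assumes w: "w \<in> webs n" and rv: "(r, v) \<in> w"
  shows "join_left v {a \<in> w. snd a < v} = {a \<in> w. snd a \<le> v}"
proof -
  let ?w = "{a \<in> w. snd a < v}"
  let ?U = "{u. 1 \<le> u \<and> u < v \<and> u \<notin> fst ` ?w \<union> snd ` ?w}"
  have rv_lt: "1 \<le> r" "r < v" "v \<le> 2 * n" using arc_bounds[OF w rv] by auto
  have "Max ?U = r"
  proof (rule Max_eqI)
    show "finite ?U" by (rule finite_subset[of _ "{..<v}"]) auto
    have "fst a \<noteq> r \<and> snd a \<noteq> r" if "a \<in> ?w" for a
      using same_arc[OF w rv, of "fst a" "snd a"] that rv_lt by auto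
    then show "r \<in> ?U" using rv_lt by blast
  next
    fix u assume u: "u \<in> ?U"
    show "u \<le> r"
    proof (rule ccontr)
      assume "\<not> u \<le> r"
      then have ru: "r < u" by simp
      have "u \<in> fst ` w \<union> snd ` w" using vertex_covered[OF w, of u] u rv_lt by simp
      then obtain k l where kl: "(k, l) \<in> w" "u = k \<or> u = l" by force
      have "l < v"
      proof (cases "u = l")
        case False
        then have "l \<le> v" using arcs_noncrossing[OF w rv kl(1)] kl(2) ru u by simp
        then show ?thesis using same_arc[OF w rv kl(1)] kl(2) False ru by (cases "l = v") auto
      qed (use u in simp)
      then have "u \<in> fst ` ?w \<union> snd ` ?w" using kl by force
      then show False using u by simp
    qed
  qed
  then have "join_left v ?w = insert (r, v) ?w" by (simp add: join_left_def)
  also have "\<dots> = {a \<in> w. snd a \<le> v}"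
  proof -
    have "{a \<in> w. snd a = v} = {(r, v)}"
    proof
      show "{a \<in> w. snd a = v} \<subseteq> {(r, v)}"
      proof
        fix a assume "a \<in> {a \<in> w. snd a = v}"
        then show "a \<in> {(r, v)}" using same_arc[OF w rv, of "fst a" "snd a"] by (cases a) simp
      qed
    qed (use rv in simp)
    then show ?thesis by (auto simp: le_less)
  qed
  finally show ?thesis .
qed

lemma fold_join_left_web:
  assumes w: "w \<in> webs n" and "sorted_wrt (<) vs" and "set vs \<subseteq> snd ` w"
    and "\<And>u v. u \<in> snd ` w \<Longrightarrow> v \<in> set vs \<Longrightarrow> u < v \<Longrightarrow> u \<in> set vs"
  shows "fold join_left vs {} = {a \<in> w. snd a \<in> set vs}"
  using assms(2-)
proof (induction vs rule: rev_induct)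
  case Nil
  then show ?case by simp
next
  case (snoc v vs)
  have less: "\<And>u. u \<in> set vs \<Longrightarrow> u < v" using snoc.prems(1) by (auto simp: sorted_wrt_append)
  have closed: "u \<in> set vs" if "u \<in> snd ` w" "x \<in> set vs" "u < x" for u x
    using snoc.prems(3)[of u x] that less[of x] by auto
  have below: "u \<in> set vs \<longleftrightarrow> u < v" if "u \<in> snd ` w" for u
    using snoc.prems(3)[of u v] that less[of u] by auto
  have "fold join_left vs {} = {a \<in> w. snd a \<in> set vs}"
  proof (rule snoc.IH)
    show "sorted_wrt (<) vs" using snoc.prems(1) by (simp add: sorted_wrt_append)
    show "set vs \<subseteq> snd ` w" using snoc.prems(2) by simp
  qed (rule closed)
  also have "\<dots> = {a \<in> w. snd a < v}" using below by auto
  finally have "fold join_left (vs @ [v]) {} = join_left v {a \<in> w. snd a < v}" by simp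
  moreover obtain r where "(r, v) \<in> w" using snoc.prems(2) by auto
  then have "join_left v {a \<in> w. snd a < v} = {a \<in> w. snd a \<le> v}" by (rule join_left_web[OF w])
  moreover have "{a \<in> w. snd a \<le> v} = {a \<in> w. snd a \<in> set (vs @ [v])}"
    using below by (auto simp: le_less)
  ultimately show ?case by simp
qed

text \<open>The tableau of a web lists the openers in its top row and the closers in its bottom row. Its
  columns increase because the first \<open>m + 1\<close> closers have \<open>m + 1\<close> different partners to the left
  of the last of them.\<close>

lemma tableau_web_surj:
  assumes w: "w \<in> webs n"
  shows "w \<in> tableau_web ` SYT2 n"
proof -
  define t b where "t = sorted_list_of_set (fst ` w)" and "b = sorted_list_of_set (snd ` w)"
  note fin = finite_web[OF w]
  have set_tb: "set t = fst ` w" "set b = snd ` w" using fin by (simp_all add: t_def b_def)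
  have srt: "sorted_wrt (<) t" "sorted_wrt (<) b" by (simp_all add: t_def b_def)
  have len: "length t = n" "length b = n"
    using card_image[OF inj_on_opener[OF w]] card_image[OF inj_on_closer[OF w]] card_web[OF w]
    by (simp_all add: t_def b_def)
  have dist: "distinct t" "distinct b" by (simp_all add: t_def b_def)
  have t_mono: "t ! l < t ! m" if "l < m" "m < n" for l m
    using sorted_wrt_nth_less[OF srt(1)] that len by simp
  have b_mono: "b ! l < b ! m" if "l < m" "m < n" for l m
    using sorted_wrt_nth_less[OF srt(2)] that len by simp
  have col: "t ! m < b ! m" if m: "m < n" for m
  proof (rule ccontr)
    assume "\<not> t ! m < b ! m"
    let ?S = "(!) b ` {..m}"
    let ?A = "{a \<in> w. snd a \<in> ?S}"
    have "?S \<subseteq> set b" using m len by auto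
    then have "?S \<subseteq> snd ` w" using set_tb(2) by simp
    moreover have "snd ` ?A = snd ` w \<inter> ?S" by auto
    ultimately have snd_A: "snd ` ?A = ?S" by blast
    have "card (snd ` ?A) = card ?A"
      by (rule card_image, rule inj_on_subset[OF inj_on_closer[OF w]]) simp
    moreover have "card (fst ` ?A) = card ?A"
      by (rule card_image, rule inj_on_subset[OF inj_on_opener[OF w]]) simp
    moreover have "card ?S = Suc m"
      using dist(2) m len by (subst card_image) (auto simp: inj_on_def nth_eq_iff_index_eq)
    ultimately have card_fst: "card (fst ` ?A) = Suc m" unfolding snd_A by simp
    have fst_sub: "fst ` ?A \<subseteq> (!) t ` {..<m}"
    proof
      fix r assume "r \<in> fst ` ?A"
      then obtain a where a: "a \<in> w" "r = fst a" "snd a \<in> ?S" by blast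
      then obtain p where "snd a = b ! p" "p \<le> m" by blast
      with a have p: "(r, b ! p) \<in> w" "p \<le> m" by (metis prod.collapse)+
      have "b ! p \<le> b ! m" using b_mono[of p m] p(2) m by (cases "p = m") auto
      then have "r < t ! m" using arc_bounds[OF w p(1)] \<open>\<not> t ! m < b ! m\<close> by simp
      have "r \<in> set t" using a(1,2) set_tb(1) by simp
      then obtain l where l: "l < n" "r = t ! l" using len by (auto simp: in_set_conv_nth)
      then have "l < m" using \<open>r < t ! m\<close> t_mono[of m l] by (cases l m rule: linorder_cases) auto
      then show "r \<in> (!) t ` {..<m}" using l(2) by blast
    qed
    from fst_sub have "card (fst ` ?A) \<le> card ((!) t ` {..<m})" by (rule card_mono[rotated]) simp
    also have "\<dots> \<le> m" using card_image_le[of "{..<m}" "(!) t"] by simp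
    finally have fst_le: "card (fst ` ?A) \<le> m" .
    show False using card_fst fst_le by simp
  qed
  have "(t, b) \<in> SYT2 n"
    unfolding SYT2_def
    using len dist srt col openers_closers_disjoint[OF w] openers_closers_cover[OF w]
    by (simp add: set_tb)
  moreover have "tableau_web (t, b) = w"
    using fold_join_left_web[OF w srt(2)] set_tb(2) by (auto simp: tableau_web_def)
  ultimately show ?thesis by (metis image_eqI)
qed

text \<open>By construction the closers are the entries of the bottom row; what remains for the top row are
  the openers.\<close>

lemma tableau_rows_of_web:
  assumes w: "tableau_web (t, b) \<in> webs n" and T: "(t, b) \<in> SYT2 n"
  shows "set t = fst ` tableau_web (t, b)" "set b = snd ` tableau_web (t, b)"
proof -
  show b: "set b = snd ` tableau_web (t, b)"
    by (simp add: tableau_web_def closers_fold_join_left)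
  have "set t = {1..2 * n} - set b"
    using T by (auto simp: SYT2_def)
  moreover have "fst ` tableau_web (t, b) = {1..2 * n} - snd ` tableau_web (t, b)"
    using openers_closers_disjoint[OF w] openers_closers_cover[OF w] by blast
  ultimately show "set t = fst ` tableau_web (t, b)"
    using b by simp
qed

theorem corollary4p5:
  fixes n :: nat and w :: web
  assumes "n \<ge> 1" and "w \<in> webs n"
  shows "web_dist n (web0 n) w = enat (nesting_number w) \<and>
    nesting_number w =
      card (inversions (2 * n) (tableau_perm (inv_into (SYT2 n) tableau_web w)))"
proof
  show "web_dist n (web0 n) w = enat (nesting_number w)"
    by (rule web_dist_eq_nesting_number[OF assms(2)])
next
  obtain t b where tb: "inv_into (SYT2 n) tableau_web w = (t, b)" by fastforce
  have T: "(t, b) \<in> SYT2 n" and eq: "tableau_web (t, b) = w"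
    using inv_into_into[OF tableau_web_surj[OF assms(2)]]
      f_inv_into_f[OF tableau_web_surj[OF assms(2)]] tb by auto
  have "set t = fst ` w" "set b = snd ` w"
    using tableau_rows_of_web[OF _ T, unfolded eq, OF assms(2)] by simp_all
  then show "nesting_number w =
      card (inversions (2 * n) (tableau_perm (inv_into (SYT2 n) tableau_web w)))"
    using ordered_pairs_inversions[OF T] ordered_pairs_nesting_number[OF assms(2)] tb by simp
qed

end
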